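(* Let $r$ be a positive integer and let $Z_n$ be the number of zeros of a random lattice path $W_n$ of length $n$ (as described in the context). For positive lengths $n\ge 2r-2$, \[ \mathbb{P}(Z_n=r)=\frac{2^r}{n+1}\frac{\binom{\lceil n/2\rceil}{r}}{\binom nr}\Bigl(\frac{2\lceil n/2\rceil}{r(r+1)}+\frac{r-1}{r+1}+[n\text{ even}]\frac1r\Bigr)+[n\text{ even}]\frac{2^{r-1}(r-1)}{(n+1)r}\frac{\binom{n/2}{r-1}}{\binom nr}, \] and $\mathbb{P}(Z_0=r)=[r=1]$. If $1\le n<2r-2$, then $\mathbb{P}(Z_n=r)=0$.
   Context: Random lattice path model: a path $W_n$ of length $n$ starts at $(0,0)$ and uses steps $(1,+1)$ and $(1,-1)$. First an endpoint $(n,D)$ is chosen with $D$ uniformly distributed on $\{-n,-n+2,\dots,n-2,n\}$; then a path is chosen uniformly at random among all paths from $(0,0)$ to $(n,D)$. A zero is a point $(x,0)$ of the path (including the origin). $[P]=1$ if $P$ is true and $0$ otherwise. *)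

theory Defs
  imports "HOL-Probability.Probability"
begin

text \<open>
  A path starting at \<open>(0, 0)\<close> is represented by its list of steps, each of which is a vector in
  \<open>\<int> \<times> \<int>\<close>; the vertices are the partial sums of the steps.
\<close>

type_synonym lattice_path = "(int \<times> int) list"

definition steps :: "(int \<times> int) set" where
  "steps = {(1, 1), (1, - 1)}"

definition vertex :: "lattice_path \<Rightarrow> nat \<Rightarrow> int \<times> int" where
  "vertex p i = sum_list (take i p)"

definition paths_to :: "nat \<Rightarrow> int \<Rightarrow> lattice_path set" where
  "paths_to n D = {p. length p = n \<and> set p \<subseteq> steps \<and> vertex p n = (int n, D)}"

definition end_heights :: "nat \<Rightarrow> int set" where
  "end_heights n = {- int n + 2 * int k | k. k \<le> n}"

definition random_path :: "nat \<Rightarrow> lattice_path pmf" where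
  "random_path n = pmf_of_set (end_heights n) \<bind> (\<lambda>D. pmf_of_set (paths_to n D))"

definition zeros :: "lattice_path \<Rightarrow> (int \<times> int) set" where
  "zeros p = {v \<in> vertex p ` {0..length p}. snd v = 0}"

definition num_zeros :: "lattice_path \<Rightarrow> nat" where
  "num_zeros p = card (zeros p)"

text \<open>
  \<^const>\<open>pmf_of_set\<close> is only meaningful on finite nonempty sets; the following facts show that
  both uses in \<^const>\<open>random_path\<close> are of this kind.
\<close>

lemma finite_end_heights: "finite (end_heights n)"
  unfolding end_heights_def by simp

lemma end_heights_nonempty: "end_heights n \<noteq> {}"
  unfolding end_heights_def by auto

lemma finite_paths_to: "finite (paths_to n D)"
proof (rule finite_subset)
  show "paths_to n D \<subseteq> {p. set p \<subseteq> steps \<and> length p = n}"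
    by (auto simp: paths_to_def)
  show "finite {p. set p \<subseteq> steps \<and> length p = n}"
    by (rule finite_lists_length_eq) (simp add: steps_def)
qed

lemma sum_list_replicate_step:
  "sum_list (replicate m (a :: int, b :: int)) = (int m * a, int m * b)"
  by (induction m) (auto simp: zero_prod_def algebra_simps)

lemma paths_to_nonempty:
  assumes "D \<in> end_heights n"
  shows "paths_to n D \<noteq> {}"
proof -
  from assms obtain k where k: "k \<le> n" "D = - int n + 2 * int k"
    by (auto simp: end_heights_def)
  have "replicate k (1, 1) @ replicate (n - k) (1, - 1) \<in> paths_to n D"
    using k by (auto simp: paths_to_def steps_def vertex_def sum_list_replicate_step of_nat_diff)
  thus ?thesis by blast
qed

end

theory Submission
  imports Defs
begin

text \<open>
  Fix the numbers \<open>u \<ge> d\<close> of up and down steps. Conditioning on the last step shows that exactly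
  \<open>2 ^ s * (C(u + d - s - 1, d - s) - C(u + d - s - 1, d - s - 1))\<close> of the paths have \<open>s + 1\<close> zeros:
  away from height \<open>0\<close> this is Pascal's rule, and at height \<open>0\<close> each of the two neighbours contributes
  the same amount, whence the powers of two. Dividing by \<open>C(n, d)\<close>, where \<open>n = u + d\<close>, leaves
  \<open>2 ^ s * (n - 2 * d + s) * C(d, s) / ((s + 1) * C(n, s + 1))\<close>, in which \<open>d\<close> occurs
  only in the numerator, so that the average over the endpoints is a hockey-stick sum.
\<close>

section \<open>Zeros of a path under appending a step\<close>

definition paths_with_zeros :: "nat \<Rightarrow> int \<Rightarrow> nat \<Rightarrow> lattice_path set" where
  "paths_with_zeros n D z = {p \<in> paths_to n D. num_zeros p = z}"

lemma finite_paths_with_zeros: "finite (paths_with_zeros n D z)"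
  unfolding paths_with_zeros_def using finite_paths_to by auto

lemma vertex_append_left: "i \<le> length p \<Longrightarrow> vertex (p @ q) i = vertex p i"
  by (simp add: vertex_def)

lemma fst_sum_list_steps: "set p \<subseteq> steps \<Longrightarrow> fst (sum_list p) = int (length p)"
  by (induction p) (auto simp: steps_def)

lemma fst_vertex: "set p \<subseteq> steps \<Longrightarrow> i \<le> length p \<Longrightarrow> fst (vertex p i) = int i"
  unfolding vertex_def
  by (subst fst_sum_list_steps) (use set_take_subset in fastforce)+

text \<open>The new endpoint has a larger first coordinate than every earlier vertex, so it is never
  already in \<open>zeros p\<close>, and a return to the axis raises the cardinality by exactly
  one.\<close>

lemma num_zeros_snoc:
  assumes "set p \<subseteq> steps" "x \<in> steps"
  shows "num_zeros (p @ [x]) = num_zeros p + of_bool (snd (vertex p (length p)) + snd x = 0)"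
proof -
  let ?v = "vertex (p @ [x]) (Suc (length p))"
  have v: "?v = vertex p (length p) + x"
    by (simp add: vertex_def)
  have "vertex (p @ [x]) ` {0..Suc (length p)} = insert ?v (vertex p ` {0..length p})"
    unfolding atLeast0AtMost atMost_Suc by (auto simp: vertex_append_left)
  hence "zeros (p @ [x]) = (if snd ?v = 0 then insert ?v (zeros p) else zeros p)"
    unfolding zeros_def by auto
  moreover have "fst ?v = int (Suc (length p))"
    using assms by (subst fst_vertex) auto
  hence "?v \<notin> zeros p"
    using fst_vertex[OF assms(1)] by (auto simp: zeros_def image_iff)
  moreover have "finite (zeros p)"
    by (simp add: zeros_def)
  ultimately show ?thesis
    using v by (simp add: num_zeros_def)
qed

section \<open>Counting paths to a given endpoint\<close>

lemma paths_to_0: "paths_to 0 D = (if D = 0 then {[]} else {})"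
  by (auto simp: paths_to_def vertex_def zero_prod_def)

text \<open>The last step is split off rather than the first: all earlier vertices then stay in
  place, so the zero count can change only at the new endpoint.\<close>

lemma paths_to_Suc:
  "paths_to (Suc n) D =
     (\<lambda>p. p @ [(1, 1)]) ` paths_to n (D - 1) \<union> (\<lambda>p. p @ [(1, - 1)]) ` paths_to n (D + 1)"
  (is "?L = ?R")
proof
  show "?R \<subseteq> ?L"
    by (auto simp: paths_to_def vertex_def steps_def)
  show "?L \<subseteq> ?R"
  proof
    fix p assume p: "p \<in> ?L"
    then obtain q x where q: "p = q @ [x]"
      by (cases p rule: rev_cases) (auto simp: paths_to_def)
    have x: "x = (1, 1) \<or> x = (1, - 1)"
      using p q by (auto simp: paths_to_def steps_def)
    show "p \<in> ?R"
      using x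
    proof
      assume "x = (1, 1)"
      hence "q \<in> paths_to n (D - 1)"
        using p q by (cases "sum_list q") (auto simp: paths_to_def vertex_def)
      thus ?thesis using \<open>x = (1, 1)\<close> q by blast
    next
      assume "x = (1, - 1)"
      hence "q \<in> paths_to n (D + 1)"
        using p q by (cases "sum_list q") (auto simp: paths_to_def vertex_def)
      thus ?thesis using \<open>x = (1, - 1)\<close> q by blast
    qed
  qed
qed

lemma card_snoc_image_Un:
  assumes "finite A" "finite B"
  shows "card ((\<lambda>p. p @ [(1, 1)]) ` A \<union> (\<lambda>p. p @ [(1, - 1)]) ` B :: lattice_path set) = card A + card B"
  using assms by (subst card_Un_disjoint) (auto simp: card_image inj_on_def)

lemma card_paths_to_Suc:
  "card (paths_to (Suc n) D) = card (paths_to n (D - 1)) + card (paths_to n (D + 1))"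
  unfolding paths_to_Suc by (intro card_snoc_image_Un finite_paths_to)

lemma paths_to_eq_empty: "\<bar>D\<bar> > int n \<Longrightarrow> paths_to n D = {}"
  by (induction n arbitrary: D) (auto simp: paths_to_0 paths_to_Suc)

lemma card_paths_to: "k \<le> n \<Longrightarrow> card (paths_to n (2 * int k - int n)) = n choose k"
proof (induction n arbitrary: k)
  case (Suc n)
  \<comment> \<open>Extends the induction hypothesis to \<open>k > n\<close>, where both sides are
    0; the case \<open>k = Suc n\<close> of the goal needs this.\<close>
  have *: "card (paths_to n (2 * int k - int n)) = n choose k" for k
    using Suc.IH[of k] paths_to_eq_empty[of n "2 * int k - int n"] by (cases "k \<le> n") auto
  show ?case
  proof (cases k)
    case 0
    thus ?thesis
      using *[of 0] paths_to_eq_empty[of n "- int n - 2"]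
      by (simp add: card_paths_to_Suc add.commute diff_diff_eq)
  next
    case (Suc j)
    have "2 * int k - int (Suc n) - 1 = 2 * int j - int n"
      and "2 * int k - int (Suc n) + 1 = 2 * int k - int n"
      using Suc by auto
    thus ?thesis
      using *[of j] *[of k] Suc by (simp only: card_paths_to_Suc) simp
  qed
qed (simp add: paths_to_0)

section \<open>Recursion for paths with a prescribed number of zeros\<close>

lemma num_zeros_snoc_paths_to:
  assumes "p \<in> paths_to n D" "x \<in> steps"
  shows "num_zeros (p @ [x]) = num_zeros p + of_bool (D + snd x = 0)"
  using assms by (subst num_zeros_snoc) (auto simp: paths_to_def)

lemma num_zeros_pos: "num_zeros p > 0"
proof -
  have "(0, 0) \<in> zeros p"
    by (force simp: zeros_def vertex_def zero_prod_def intro!: image_eqI[of _ _ 0])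
  thus ?thesis
    by (auto simp: num_zeros_def card_gt_0_iff zeros_def)
qed

lemma num_zeros_Nil: "num_zeros [] = 1"
proof -
  have "zeros [] = {0}"
    by (auto simp: zeros_def vertex_def)
  thus ?thesis by (simp add: num_zeros_def)
qed

lemma card_paths_with_zeros_0:
  "card (paths_with_zeros 0 D z) = of_bool (D = 0 \<and> z = 1)"
  by (auto simp: paths_with_zeros_def paths_to_0 num_zeros_Nil cong: conj_cong)

lemma card_paths_with_zeros_Suc:
  assumes "D \<noteq> 0"
  shows "card (paths_with_zeros (Suc n) D z) =
    card (paths_with_zeros n (D - 1) z) + card (paths_with_zeros n (D + 1) z)"
proof -
  have "paths_with_zeros (Suc n) D z =
      (\<lambda>p. p @ [(1, 1)]) ` paths_with_zeros n (D - 1) z \<union>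
      (\<lambda>p. p @ [(1, - 1)]) ` paths_with_zeros n (D + 1) z"
    using assms unfolding paths_with_zeros_def paths_to_Suc
    by (auto simp: num_zeros_snoc_paths_to steps_def)
  thus ?thesis
    by (simp only: card_snoc_image_Un finite_paths_with_zeros)
qed

lemma card_paths_with_zeros_Suc_0:
  "card (paths_with_zeros (Suc n) 0 (Suc z)) =
    card (paths_with_zeros n (- 1) z) + card (paths_with_zeros n 1 z)"
proof -
  have "paths_with_zeros (Suc n) 0 (Suc z) =
      (\<lambda>p. p @ [(1, 1)]) ` paths_with_zeros n (- 1) z \<union>
      (\<lambda>p. p @ [(1, - 1)]) ` paths_with_zeros n 1 z"
    unfolding paths_with_zeros_def paths_to_Suc
    by (auto simp: num_zeros_snoc_paths_to steps_def)
  thus ?thesis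
    by (simp only: card_snoc_image_Un finite_paths_with_zeros)
qed

lemma paths_with_zeros_eq_empty: "\<bar>D\<bar> > int n \<Longrightarrow> paths_with_zeros n D z = {}"
  by (simp add: paths_with_zeros_def paths_to_eq_empty)

lemma paths_with_no_zeros: "paths_with_zeros n D 0 = {}"
  using num_zeros_pos by (auto simp: paths_with_zeros_def)

text \<open>Reflection in the axis. The recursion gives it without an explicit bijection, since
  negating \<open>D\<close> swaps the two summands.\<close>

lemma card_paths_with_zeros_uminus:
  "card (paths_with_zeros n (- D) z) = card (paths_with_zeros n D z)"
proof (induction n arbitrary: D z)
  case (Suc n)
  show ?case
  proof (cases "D = 0")
    case False
    thus ?thesis
      using Suc.IH[of "D + 1" z] Suc.IH[of "D - 1" z]
      by (simp add: card_paths_with_zeros_Suc)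
  qed simp
qed (simp add: card_paths_with_zeros_0)

section \<open>Ballot numbers and the count for a fixed endpoint\<close>

text \<open>
  The second binomial coefficient is \<open>C(u + m - 1, m - 1)\<close>, reflected so that no truncated
  subtraction occurs at \<open>m = 0\<close>.
\<close>

definition ballot :: "nat \<Rightarrow> nat \<Rightarrow> int" where
  "ballot u m = int (u + m - 1 choose m) - int (u + m - 1 choose u)"

lemma ballot_0: "u > 0 \<Longrightarrow> ballot u 0 = 1"
  by (simp add: ballot_def)

lemma ballot_same: "ballot u u = 0"
  by (simp add: ballot_def)

lemma ballot_Suc_Suc: "ballot (Suc u) (Suc m) = ballot (Suc u) m + ballot u (Suc m)"
  by (simp add: ballot_def)

text \<open>The ballot theorem, multiplied out to stay in the integers: absorption turns the two
  binomials into the shares \<open>u / (u + m)\<close> and \<open>m / (u + m)\<close> of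
  \<open>u + m choose m\<close>.\<close>

lemma ballot_closed_form:
  assumes "u + m > 0"
  shows "(int u + int m) * ballot u m = (int u - int m) * int (u + m choose m)"
proof -
  obtain N where N: "u + m = Suc N"
    using assms gr0_implies_Suc by blast
  have 1: "(u + m) * (N choose m) = u * (u + m choose m)"
    using binomial_absorb_comp[of "Suc N" m] N by (metis add_diff_cancel_right' diff_Suc_1)
  have 2: "(u + m) * (N choose u) = m * (u + m choose m)"
    using binomial_absorb_comp[of "Suc N" u] N binomial_symmetric[of m "u + m"]
    by (metis add_diff_cancel_right' add_diff_cancel_left' diff_Suc_1 le_add2)
  have "(int u + int m) * ballot u m = int ((u + m) * (N choose m)) - int ((u + m) * (N choose u))"
    by (simp only: ballot_def N diff_Suc_1 of_nat_mult right_diff_distrib flip: of_nat_add)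
  also have "\<dots> = (int u - int m) * int (u + m choose m)"
    unfolding 1 2 by (simp add: algebra_simps)
  finally show ?thesis .
qed

text \<open>Both sides obey the same recursion in the length. On the axis \<open>d\<close> and
  \<open>s\<close> drop together, so \<open>d - s\<close> is kept while a factor 2 splits off. The
  conditional guards against truncated subtraction, which would give \<open>ballot u 0 = 1\<close>
  for \<open>d < s\<close>; \<open>u > 0\<close> excludes the empty path.\<close>

lemma card_paths_with_zeros:
  assumes "d \<le> u" "u > 0"
  shows "int (card (paths_with_zeros (u + d) (int u - int d) (Suc s))) =
    (if d < s then 0 else 2 ^ s * ballot u (d - s))"
  using assms
proof (induction "u + d" arbitrary: u d s)
  case 0
  thus ?case by simp
next
  case (Suc n)
  let ?F = "\<lambda>u d s. int (card (paths_with_zeros (u + d) (int u - int d) (Suc s)))"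
  obtain v where v: "u = Suc v"
    using Suc.prems gr0_implies_Suc by blast
  show ?case
  proof (cases "d = u")
    case True
    have rec: "?F u d s = 2 * int (card (paths_with_zeros (u + v) 1 s))"
      using True v card_paths_with_zeros_Suc_0[of "u + v" s]
        card_paths_with_zeros_uminus[of "u + v" 1 s] by simp
    show ?thesis
    proof (cases s)
      case 0
      \<comment> \<open>A return to the axis makes a second zero, so no path is counted here, in
        agreement with \<open>ballot u u = 0\<close>.\<close>
      thus ?thesis
        using rec True by (simp add: paths_with_no_zeros ballot_same)
    next
      case (Suc t)
      have "int (card (paths_with_zeros (u + v) 1 s)) = (if v < t then 0 else 2 ^ t * ballot u (v - t))"
        using Suc.hyps(1)[of u v t] Suc.hyps(2) v True Suc by simp
      thus ?thesis
        using rec Suc v True by simp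
    qed
  next
    case False
    hence "d < u" using Suc.prems by simp
    have n: "u + d = Suc n" "n = v + d"
      using Suc.hyps(2) v by auto
    have rec: "?F u d s = ?F v d s + int (card (paths_with_zeros n (int u - int d + 1) (Suc s)))"
      using card_paths_with_zeros_Suc[of "int u - int d" n "Suc s"] \<open>d < u\<close> n v by simp
    show ?thesis
    proof (cases "v = 0")
      \<comment> \<open>Here \<open>u = 1\<close> and \<open>d = 0\<close>: the predecessor is the
        empty path, outside the induction hypothesis.\<close>
      case True
      thus ?thesis
        using rec v n \<open>d < u\<close> card_paths_with_zeros_0 by (simp add: paths_with_zeros_eq_empty ballot_0)
    next
      case False
      hence IH1: "?F v d s = (if d < s then 0 else 2 ^ s * ballot v (d - s))"
        using Suc.hyps(1)[of v d s] \<open>d < u\<close> n v by simp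
      show ?thesis
      proof (cases d)
        \<comment> \<open>Without down steps the upper neighbour lies out of reach.\<close>
        case 0
        thus ?thesis
          using rec IH1 v n False by (simp add: paths_with_zeros_eq_empty ballot_0)
      next
        case (Suc e)
        hence "int u - int d + 1 = int u - int e" "n = u + e"
          using n v by auto
        hence IH2: "int (card (paths_with_zeros n (int u - int d + 1) (Suc s))) =
            (if e < s then 0 else 2 ^ s * ballot u (e - s))"
          using Suc.hyps(1)[of u e s] \<open>d < u\<close> Suc by simp
        \<comment> \<open>At \<open>d = s\<close> only the lower neighbour contributes, and
          \<open>ballot\<close> is 1 on both sides; the Pascal rule applies once
          \<open>s \<le> e\<close>.\<close>
        consider "d < s" | "d = s" | "s \<le> e"
          using Suc by linarith
        thus ?thesis
        proof cases
          case 3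
          hence "d - s = Suc (e - s)" using Suc by simp
          thus ?thesis
            using rec IH1 IH2 3 v Suc by (simp add: ballot_Suc_Suc algebra_simps)
        qed (use rec IH1 IH2 Suc False v in \<open>simp_all add: ballot_0\<close>)
      qed
    qed
  qed
qed

text \<open>The case \<open>n = 0\<close> must be excluded: the empty path has one zero, but the formula gives \<open>0\<close> for \<open>s = 0\<close>.\<close>

lemma prob_zeros_given_endpoint:
  assumes "2 * d \<le> n" "n > 0"
  shows "real (card (paths_with_zeros n (int n - 2 * int d) (Suc s))) / real (n choose d) =
    2 ^ s * (real n + real s - 2 * real d) * real (d choose s) / (real (Suc s) * real (n choose Suc s))"
proof -
  define u where "u = n - d"
  have u: "n = u + d" "d \<le> u" "u > 0"
    using assms by (auto simp: u_def)
  have card: "int (card (paths_with_zeros n (int n - 2 * int d) (Suc s))) =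
      (if d < s then 0 else 2 ^ s * ballot u (d - s))"
    using card_paths_with_zeros[OF u(2,3), of s] u(1) by simp
  show ?thesis
  proof (cases "d < s")
    case True
    thus ?thesis using card by simp
  next
    case False
    define m where "m = d - s"
    have d: "d = s + m"
      using False by (simp add: m_def)
    let ?A = "real (card (paths_with_zeros n (int n - 2 * int d) (Suc s)))"
    have "(int u + int m) * int (card (paths_with_zeros n (int n - 2 * int d) (Suc s))) =
        2 ^ s * ((int u - int m) * int (u + m choose m))"
      using card False u ballot_closed_form[of u m] by (simp add: m_def)
    hence "real_of_int ((int u + int m) * int (card (paths_with_zeros n (int n - 2 * int d) (Suc s)))) =
        real_of_int (2 ^ s * ((int u - int m) * int (u + m choose m)))"
      by (rule arg_cong)
    hence 1: "(real u + real m) * ?A = 2 ^ s * (real u - real m) * real (u + m choose m)"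
      by simp
    \<comment> \<open>Trinomial revision, using \<open>n - s = u + m\<close> and
      \<open>d - s = m\<close>. This moves \<open>d\<close> out of the denominator.\<close>
    have "(n choose d) * (d choose s) = (n choose s) * (u + m choose m)"
      using choose_mult[of s d n] u d by simp
    hence 2: "real (n choose d) * real (d choose s) = real (n choose s) * real (u + m choose m)"
      by (metis of_nat_mult)
    have "Suc s * (n choose Suc s) = (u + m) * (n choose s)"
      using binomial_absorption[of s n] binomial_absorb_comp[of n s] u d by simp
    hence 3: "real (Suc s) * real (n choose Suc s) = (real u + real m) * real (n choose s)"
      by (metis of_nat_add of_nat_mult)
    have pos: "real (n choose d) > 0" "real (n choose s) > 0" "real u + real m > 0"
      using u d by auto
    have "?A * (real (Suc s) * real (n choose Suc s)) = ((real u + real m) * ?A) * real (n choose s)"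
      unfolding 3 by simp
    also have "\<dots> = 2 ^ s * (real u - real m) * (real (n choose s) * real (u + m choose m))"
      unfolding 1 by simp
    also have "\<dots> = 2 ^ s * (real n + real s - 2 * real d) * real (d choose s) * real (n choose d)"
      unfolding 2[symmetric] using u d by simp
    finally show ?thesis
      using pos unfolding 3 by (simp add: frac_eq_eq)
  qed
qed

section \<open>Summation identities\<close>

text \<open>A hockey-stick sum with linear weight, scaled by \<open>s + 2\<close> to clear the
  denominator. The induction step rests on
  \<open>(s + 1) * C(h, s + 1) = (h - s) * C(h, s)\<close>.\<close>

lemma sum_linear_times_choose:
  fixes c :: real
  shows "(real s + 2) * (\<Sum>k<h. (c - 2 * real k) * real (k choose s)) =
    (c * (real s + 2) - 2 * (real s + 1) * real h + 2) * real (h choose Suc s)"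
proof (induction h)
  case (Suc h)
  have "Suc s * (h choose Suc s) = (h - s) * (h choose s)"
    using binomial_absorption[of s h] binomial_absorb_comp[of h s] by simp
  hence "(real s + 1) * real (h choose Suc s) = real (h - s) * real (h choose s)"
    by (metis of_nat_Suc of_nat_mult add.commute)
  \<comment> \<open>For \<open>h < s\<close> the truncated and the real difference disagree, but
    \<open>h choose s\<close> is then 0.\<close>
  also have "\<dots> = (real h - real s) * real (h choose s)"
    by (cases "s \<le> h") (auto simp: of_nat_diff)
  finally have "(real s + 1) * real (h choose Suc s) = (real h - real s) * real (h choose s)" .
  with Suc.IH show ?case
    by (simp only: sum.lessThan_Suc distrib_left binomial_Suc_Suc of_nat_add of_nat_Suc) algebra
qed simp

text \<open>Needed because the count for a fixed endpoint covers only \<open>d \<le> u\<close>. The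
  upper half mirrors the lower one, and a middle index remains only for even
  \<open>n\<close>.\<close>

lemma sum_symmetric_fold:
  fixes t :: "nat \<Rightarrow> real"
  assumes "\<And>k. k \<le> n \<Longrightarrow> t (n - k) = t k"
  shows "(\<Sum>k\<le>n. t k) = 2 * (\<Sum>k<(n + 1) div 2. t k) + of_bool (even n) * t (n div 2)"
proof -
  define h where "h = (n + 1) div 2"
  have refl: "(\<Sum>k\<in>{n - h<..n}. t k) = (\<Sum>k<h. t k)"
    by (rule sum.reindex_bij_witness[of _ "\<lambda>k. n - k" "\<lambda>k. n - k"]) (auto simp: assms h_def)
  have "{..n} = {..<h} \<union> {h..n - h} \<union> {n - h<..n}"
    by (auto simp: h_def)
  hence "(\<Sum>k\<le>n. t k) = (\<Sum>k<h. t k) + (\<Sum>k\<in>{h..n - h}. t k) + (\<Sum>k\<in>{n - h<..n}. t k)"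
    by (simp only:) (subst sum.union_disjoint; auto simp: h_def)+
  moreover have "{h..n - h} = (if even n then {n div 2} else {})"
    by (auto simp: h_def elim!: evenE oddE)
  ultimately show ?thesis
    using refl by (simp add: h_def)
qed

section \<open>Averaging over the endpoints\<close>

text \<open>Law of total probability, with \<open>k\<close> the number of up steps: the
  \<open>n + 1\<close> endpoints are equally likely, and \<open>n choose k\<close> paths lead to
  each.\<close>

lemma prob_num_zeros:
  "measure_pmf.prob (random_path n) {p. num_zeros p = z} =
    (\<Sum>k\<le>n. real (card (paths_with_zeros n (2 * int k - int n) z)) / real (n choose k)) / (real n + 1)"
proof -
  let ?X = "{p. num_zeros p = z}"
  let ?D = "\<lambda>k. 2 * int k - int n"
  have ends: "end_heights n = ?D ` {..n}"
    by (auto simp: end_heights_def)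
  have inj: "inj_on ?D {..n}"
    by (auto simp: inj_on_def)
  have prob: "measure_pmf.prob (pmf_of_set (paths_to n (?D k))) ?X =
      real (card (paths_with_zeros n (?D k) z)) / real (n choose k)" if "k \<le> n" for k
  proof -
    have "?D k \<in> end_heights n"
      using that ends by auto
    moreover have "paths_to n (?D k) \<inter> ?X = paths_with_zeros n (?D k) z"
      by (auto simp: paths_with_zeros_def)
    ultimately show ?thesis
      using that by (simp add: measure_pmf_of_set paths_to_nonempty finite_paths_to card_paths_to)
  qed
  have "measure_pmf.prob (random_path n) ?X =
      measure_pmf.expectation (pmf_of_set (end_heights n))
        (\<lambda>D. measure_pmf.prob (pmf_of_set (paths_to n D)) ?X)"
    unfolding random_path_def measure_pmf_bind
    by (rule measure_pmf.measure_bind[where N = "count_space UNIV"])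
      (auto simp: measure_pmf_in_subprob_algebra)
  also have "\<dots> = (\<Sum>D\<in>end_heights n. measure_pmf.prob (pmf_of_set (paths_to n D)) ?X) /
      real (card (end_heights n))"
    by (rule integral_pmf_of_set[OF end_heights_nonempty finite_end_heights])
  also have "\<dots> = (\<Sum>k\<le>n. measure_pmf.prob (pmf_of_set (paths_to n (?D k))) ?X) / (real n + 1)"
    unfolding ends by (simp add: sum.reindex[OF inj] card_image[OF inj] add.commute)
  finally show ?thesis
    by (simp add: prob)
qed

lemma prob_num_zeros_half:
  fixes n s :: nat
  defines "t \<equiv> \<lambda>d. (real n + real s - 2 * real d) * real (d choose s)"
  assumes "n > 0"
  shows "measure_pmf.prob (random_path n) {p. num_zeros p = Suc s} =
    2 ^ s / ((real n + 1) * real (Suc s) * real (n choose Suc s)) *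
      (2 * (\<Sum>d<(n + 1) div 2. t d) + of_bool (even n) * t (n div 2))"
proof -
  define q where "q = (\<lambda>k. real (card (paths_with_zeros n (2 * int k - int n) (Suc s))) / real (n choose k))"
  define c where "c = 2 ^ s / (real (Suc s) * real (n choose Suc s))"
  have sym: "q (n - k) = q k" if "k \<le> n" for k
    using that card_paths_with_zeros_uminus[of n "2 * int k - int n" "Suc s"]
    by (simp add: q_def of_nat_diff binomial_symmetric[OF that])
  \<comment> \<open>The index now counts down steps; reflection turns the height
    \<open>2 * d - n\<close> into the \<open>n - 2 * d\<close> of the conditional formula.\<close>
  have q: "q d = c * t d" if "2 * d \<le> n" for d
    using prob_zeros_given_endpoint[OF that assms(2), of s]
      card_paths_with_zeros_uminus[of n "2 * int d - int n" "Suc s"]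
    by (simp add: q_def c_def t_def)
  have "(\<Sum>k\<le>n. q k) = 2 * (\<Sum>k<(n + 1) div 2. q k) + of_bool (even n) * q (n div 2)"
    using sym by (rule sum_symmetric_fold)
  also have "(\<Sum>k<(n + 1) div 2. q k) = (\<Sum>k<(n + 1) div 2. c * t k)"
    by (intro sum.cong refl q) auto
  also have "\<dots> = c * (\<Sum>k<(n + 1) div 2. t k)"
    by (simp add: sum_distrib_left)
  also have "q (n div 2) = c * t (n div 2)"
    by (rule q) auto
  finally have "(\<Sum>k\<le>n. q k) =
      c * (2 * (\<Sum>d<(n + 1) div 2. t d) + of_bool (even n) * t (n div 2))"
    by (simp only: distrib_left mult_ac)
  moreover have "measure_pmf.prob (random_path n) {p. num_zeros p = Suc s} =
      (\<Sum>k\<le>n. q k) / (real n + 1)"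
    by (simp only: prob_num_zeros q_def)
  ultimately show ?thesis
    by (simp only: c_def times_divide_eq_left divide_divide_eq_left mult_ac)
qed

lemma prob_num_zeros_closed_form:
  fixes n s :: nat
  defines "h \<equiv> (n + 1) div 2"
  assumes "n > 0"
  shows "measure_pmf.prob (random_path n) {p. num_zeros p = Suc s} =
    2 ^ s / ((real n + 1) * real (Suc s) * real (n choose Suc s)) *
      (2 * ((real n + real s) * (real s + 2) - 2 * (real s + 1) * real h + 2) / (real s + 2)
          * real (h choose Suc s)
        + of_bool (even n) * real s * real (n div 2 choose s))"
proof -
  have sum: "(\<Sum>d<h. (real n + real s - 2 * real d) * real (d choose s)) =
      ((real n + real s) * (real s + 2) - 2 * (real s + 1) * real h + 2) * real (h choose Suc s)
        / (real s + 2)"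
    by (subst sum_linear_times_choose[symmetric]) simp
  \<comment> \<open>At the midpoint \<open>2 * d = n\<close>, so the linear factor reduces to
    \<open>s\<close>.\<close>
  have mid: "of_bool (even n) * ((real n + real s - 2 * real (n div 2)) * x) =
      of_bool (even n) * real s * x" for x
    by (auto elim!: evenE)
  show ?thesis
    unfolding prob_num_zeros_half[OF assms(2)] h_def[symmetric] sum mid
    by (simp only: times_divide_eq_right times_divide_eq_left mult_ac)
qed

section \<open>Matching the stated formula\<close>

theorem theorem9p1:
  fixes r n :: nat
  assumes "r > 0"
  shows
    "(n > 0 \<and> n \<ge> 2 * r - 2 \<longrightarrow>
        measure_pmf.prob (random_path n) {p. num_zeros p = r} =
          2 ^ r / (real n + 1) * (real (nat \<lceil>real n / 2\<rceil> choose r) / real (n choose r)) *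
            (2 * real_of_int \<lceil>real n / 2\<rceil> / (real r * (real r + 1)) + (real r - 1) / (real r + 1) +
              of_bool (even n) * (1 / real r)) +
          of_bool (even n) * (2 ^ (r - 1) * (real r - 1) / ((real n + 1) * real r)) *
            (real ((n div 2) choose (r - 1)) / real (n choose r))) \<and>
     measure_pmf.prob (random_path 0) {p. num_zeros p = r} = of_bool (r = 1) \<and>
     (1 \<le> n \<and> n < 2 * r - 2 \<longrightarrow>
        measure_pmf.prob (random_path n) {p. num_zeros p = r} = 0)"
proof -
  obtain s where r: "r = Suc s"
    using assms gr0_implies_Suc by blast
  define h where "h = (n + 1) div 2"
  have ceil: "\<lceil>real n / 2\<rceil> = int h"
    unfolding h_def by (rule ceiling_unique) (cases "even n"; auto elim!: evenE oddE)+
  \<comment> \<open>Lets \<open>n\<close> be eliminated in favour of \<open>h\<close> and the parity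
    indicator.\<close>
  have n: "real n = 2 * real h - 1 + of_bool (even n)"
    unfolding h_def by (cases "even n") (auto elim!: evenE oddE)
  have pos_case: "measure_pmf.prob (random_path n) {p. num_zeros p = r} =
          2 ^ r / (real n + 1) * (real (nat \<lceil>real n / 2\<rceil> choose r) / real (n choose r)) *
            (2 * real_of_int \<lceil>real n / 2\<rceil> / (real r * (real r + 1)) + (real r - 1) / (real r + 1) +
              of_bool (even n) * (1 / real r)) +
          of_bool (even n) * (2 ^ (r - 1) * (real r - 1) / ((real n + 1) * real r)) *
            (real ((n div 2) choose (r - 1)) / real (n choose r))" if "n > 0"
  proof -
    define e :: real where "e = of_bool (even n)"
    \<comment> \<open>Once divided by \<open>(s + 2) * (s + 1)\<close>, the three summands become
      the three terms of the bracket in the claim.\<close>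
    have "(real n + real s) * (real s + 2) - 2 * (real s + 1) * real h + 2 =
        2 * real h + real s * (real s + 1) + e * (real s + 2)"
      unfolding e_def n by (simp add: algebra_simps)
    also have "\<dots> / (real s + 2) / (real s + 1) =
        2 * real h / ((real s + 1) * (real s + 2)) + real s / (real s + 2) + e / (real s + 1)"
      by (simp add: divide_simps)
    finally have main: "((real n + real s) * (real s + 2) - 2 * (real s + 1) * real h + 2)
          / (real s + 2) / (real s + 1) =
        2 * real h / ((real s + 1) * (real s + 2)) + real s / (real s + 2) + e / (real s + 1)" .
    \<comment> \<open>Used with \<open>p = 2 ^ s\<close>, where the 2 from folding completes
      \<open>2 ^ r\<close>. The division laws applied hold for zero denominators too, so no side
      conditions arise.\<close>
    have rearrange: "p / (a * b * c) * (2 * K / y * B + e * v * M) =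
        2 * p / a * (B / c) * (K / y / b) + e * (p * v / (a * b)) * (M / c)"
      for p a b c K y B v M :: real
      by (simp only: distrib_left times_divide_eq_left times_divide_eq_right
          divide_divide_eq_left mult_ac)
    have "measure_pmf.prob (random_path n) {p. num_zeros p = r} =
        2 ^ r / (real n + 1) * (real (h choose r) / real (n choose r)) *
          (((real n + real s) * (real s + 2) - 2 * (real s + 1) * real h + 2)
            / (real s + 2) / (real s + 1)) +
        e * (2 ^ s * real s / ((real n + 1) * (real s + 1))) *
          (real (n div 2 choose s) / real (n choose r))"
      unfolding r prob_num_zeros_closed_form[OF that] h_def[symmetric] e_def[symmetric] rearrange
      by (simp only: power_Suc of_nat_Suc add.commute)
    thus ?thesis
      unfolding main by (simp add: ceil r e_def add.commute add.left_commute del: binomial_Suc_Suc)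
  qed
  moreover have "measure_pmf.prob (random_path 0) {p. num_zeros p = r} = of_bool (r = 1)"
    by (simp add: prob_num_zeros card_paths_with_zeros_0)
  moreover have "measure_pmf.prob (random_path n) {p. num_zeros p = r} = 0"
    if "1 \<le> n" "n < 2 * r - 2"
  proof -
    \<comment> \<open>These bounds make both binomials in the numerators vanish.\<close>
    have "h < r" "n div 2 < s"
      using that r by (auto simp: h_def)
    thus ?thesis
      unfolding r using that prob_num_zeros_closed_form[of n s] r
      by (simp add: binomial_eq_0 flip: h_def del: binomial_Suc_Suc)
  qed
  ultimately show ?thesis by blast
qed

end
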